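(* Let $r\geq -1$ be an integer and let $G$ be a finite group such that $|C(G)|=\frac{|G|+(2r+1)}{2}$. Then: (1) $r=-1$ if and only if $G\cong\mathbb{Z}_5$. (2) $r=0$ if and only if $G\cong\{e\}$ or $\exp(G)=3$. (3) For $r\geq 1$ there is no such group $G$.
   Context: For a finite group $G$, $C(G)$ is the set of all cyclic subgroups of $G$ (including the trivial one), and $\exp(G)$ is the exponent of $G$. $\mathbb{Z}_n$ is the cyclic group of order $n$. *)

theory Defs
  imports "HOL-Algebra.Algebra"
begin

definition cyclic_subgroups :: "('a, 'b) monoid_scheme \<Rightarrow> 'a set set" where
  "cyclic_subgroups G = {H. subgroup H G \<and> cyclic_group (G\<lparr>carrier := H\<rparr>)}"

(* For a finite group such a positive n always exists (for instance the order of G). *)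
definition group_exponent :: "('a, 'b) monoid_scheme \<Rightarrow> nat" where
  "group_exponent G = (LEAST n. 0 < n \<and> (\<forall>x\<in>carrier G. x [^]\<^bsub>G\<^esub> n = \<one>\<^bsub>G\<^esub>))"

end

theory Submission
  imports Defs
begin

text \<open>The hypothesis forces \<open>|G|\<close> to be odd. Then every nontrivial cyclic subgroup has at least two
  generators, say \<open>x\<close> and its inverse, and counting the elements of \<open>G\<close> by the subgroup that they
  generate gives \<open>\<Sum>\<^bsub>C\<^esub> (g(C) - 2) = -2r\<close>, where \<open>g(C)\<close> is the number of generators of \<open>C\<close> and \<open>C\<close>
  runs over the nontrivial cyclic subgroups. If \<open>x\<^sup>3 \<noteq> 1\<close>, then \<open>x\<close>, \<open>x\<^sup>2\<close> and their inverses are four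
  distinct generators of one subgroup. So \<open>r \<ge> 1\<close> is impossible, \<open>r = 0\<close> forces \<open>x\<^sup>3 = 1\<close> throughout,
  and for \<open>r = -1\<close> there are exactly four elements with \<open>x\<^sup>3 \<noteq> 1\<close>, the nontrivial powers of an element
  of order 5. An element \<open>y\<close> with \<open>y\<^sup>3 = 1\<close> then acts on these powers by a conjugation whose cube is
  trivial, hence trivially as the automorphism group has order 4. So \<open>(yx)\<^sup>3 = x\<^sup>3 \<noteq> 1\<close>, which makes
  \<open>yx\<close>, and thus \<open>y\<close>, a power of \<open>x\<close>.\<close>

section \<open>Cyclic subgroups as subgroups generated by one element\<close>

lemma (in group) generate_singleton_eq_range:
  "x \<in> carrier G \<Longrightarrow> generate G {x} = range (\<lambda>k::int. x [^] k)"
  by (simp add: generate_pow full_SetCompr_eq)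

lemma (in group) cyclic_subgroups_eq_image:
  "cyclic_subgroups G = (\<lambda>x. generate G {x}) ` carrier G"
proof (intro equalityI subsetI)
  fix H assume "H \<in> cyclic_subgroups G"
  then have H: "subgroup H G" and c: "cyclic_group (G\<lparr>carrier := H\<rparr>)"
    by (auto simp: cyclic_subgroups_def)
  interpret H: group "G\<lparr>carrier := H\<rparr>"
    using H subgroup.subgroup_is_group by blast
  from c obtain x where x: "x \<in> H" "H = range (\<lambda>n::int. x [^]\<^bsub>G\<lparr>carrier := H\<rparr>\<^esub> n)"
    by (auto simp: H.cyclic_group)
  then have "H = range (\<lambda>n::int. x [^] n)"
    using int_pow_consistent[OF H] by simp
  moreover have "x \<in> carrier G"
    using subgroup.mem_carrier[OF H] x by simp
  ultimately show "H \<in> (\<lambda>x. generate G {x}) ` carrier G"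
    by (metis generate_singleton_eq_range image_eqI)
next
  fix H assume "H \<in> (\<lambda>x. generate G {x}) ` carrier G"
  then obtain x where x: "x \<in> carrier G" "H = generate G {x}" by auto
  then have H: "subgroup H G"
    by (simp add: generate_is_subgroup)
  interpret H: group "G\<lparr>carrier := H\<rparr>"
    using H subgroup.subgroup_is_group by blast
  have "x \<in> H"
    using x by (simp add: generate.incl)
  moreover have "H = range (\<lambda>n::int. x [^]\<^bsub>G\<lparr>carrier := H\<rparr>\<^esub> n)"
    unfolding int_pow_consistent[OF H \<open>x \<in> H\<close>, symmetric]
    using x(2) generate_singleton_eq_range[OF x(1)] by (rule trans)
  ultimately have "\<exists>x\<in>H. H = range (\<lambda>n::int. x [^]\<^bsub>G\<lparr>carrier := H\<rparr>\<^esub> n)"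
    by (rule bexI[rotated])
  then show "H \<in> cyclic_subgroups G"
    using H by (simp add: cyclic_subgroups_def H.cyclic_group)
qed

text \<open>By Bezout, \<open>k\<close> has an inverse \<open>j\<close> modulo \<open>ord x\<close>,
  so \<open>x\<close> is itself a power of \<open>x [^] k\<close> and each generated subgroup
  contains the other.\<close>

lemma (in group) generate_int_pow_coprime:
  assumes x: "x \<in> carrier G" and "coprime k (int (ord x))"
  shows "generate G {x [^] k} = generate G {x}"
proof -
  have sub: "generate G {y [^] j} \<subseteq> generate G {y}" if "y \<in> carrier G" for y and j :: int
    using that by (auto simp: generate_singleton_eq_range int_pow_pow)
  obtain j l where "j * k + l * int (ord x) = 1"
    using assms(2) bezout_int[of k "int (ord x)"] by auto
  then have "1 - k * j = int (ord x) * l"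
    by (simp add: algebra_simps)
  then have "(x [^] k) [^] j = x [^] (1::int)"
    using x by (simp add: int_pow_pow int_pow_eq del: int_pow_1)
  then show ?thesis
    using sub[OF x, of k] sub[of "x [^] k" j] x by (simp add: int_pow_pow)
qed

section \<open>Counting elements by the subgroup they generate\<close>

definition generators :: "('a, 'b) monoid_scheme \<Rightarrow> 'a set \<Rightarrow> 'a set" where
  "generators G C = {y \<in> carrier G - {\<one>\<^bsub>G\<^esub>}. generate G {y} = C}"

definition nontriv_cyclic :: "('a, 'b) monoid_scheme \<Rightarrow> 'a set set" where
  "nontriv_cyclic G = (\<lambda>x. generate G {x}) ` (carrier G - {\<one>\<^bsub>G\<^esub>})"

context group
begin

text \<open>The sets of generators are the fibres of \<open>x \<mapsto> generate G {x}\<close> on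
  the non-identity elements; the summand 1 is the identity.\<close>

lemma order_eq_sum_card_generators:
  assumes "finite (carrier G)"
  shows "order G = 1 + (\<Sum>C \<in> nontriv_cyclic G. card (generators G C))"
proof -
  have "card (carrier G - {\<one>}) = (\<Sum>C \<in> nontriv_cyclic G. card (generators G C))"
    using sum.image_gen[of "carrier G - {\<one>}" "\<lambda>_. 1::nat" "\<lambda>x. generate G {x}"] assms
    by (simp add: nontriv_cyclic_def generators_def)
  then show ?thesis
    using card_Suc_Diff1[of "carrier G" \<one>] assms by (simp add: order_def)
qed

lemma card_cyclic_subgroups:
  assumes "finite (carrier G)"
  shows "card (cyclic_subgroups G) = 1 + card (nontriv_cyclic G)"
proof -
  have "carrier G = insert \<one> (carrier G - {\<one>})" by auto
  then have "cyclic_subgroups G = insert (generate G {\<one>}) (nontriv_cyclic G)"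
    unfolding cyclic_subgroups_eq_image nontriv_cyclic_def by (metis image_insert)
  moreover have "generate G {\<one>} \<notin> nontriv_cyclic G"
    unfolding nontriv_cyclic_def generate_one
    using generate.incl[of _ "{_}" G] by (auto simp: set_eq_iff)
  ultimately show ?thesis
    using assms by (simp add: nontriv_cyclic_def)
qed

end

section \<open>Generators in groups of odd order\<close>

locale odd_group = group +
  assumes fin: "finite (carrier G)" and odd_order: "odd (order G)"
begin

lemma odd_ord: "x \<in> carrier G \<Longrightarrow> odd (ord x)"
  using ord_dvd_group_order[of x] odd_order dvd_trans[of 2 "ord x" "order G"] by blast

text \<open>As 2 is coprime to the odd order, factors of 2 can be stripped from any exponent that
  kills \<open>x\<close>.\<close>

lemma dvd_2_ord: "x \<in> carrier G \<Longrightarrow> int (ord x) dvd 2 * k \<longleftrightarrow> int (ord x) dvd k"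
  using odd_ord[of x] by (simp add: coprime_dvd_mult_right_iff)

lemma eq_one_if_ord_dvd_2: "x \<in> carrier G \<Longrightarrow> int (ord x) dvd 2 \<longleftrightarrow> x = \<one>"
  using dvd_2_ord[of x 1] ord_eq_1[of x] int_dvd_int_iff[of "ord x" 1] by simp

lemma finite_generators: "finite (generators G C)"
  using fin by (simp add: generators_def)

lemma int_pow_in_generators:
  assumes "x \<in> carrier G" "x \<noteq> \<one>" "coprime k (int (ord x))"
  shows "x [^] k \<in> generators G (generate G {x})"
proof -
  have g: "generate G {x [^] k} = generate G {x}"
    using assms generate_int_pow_coprime by simp
  have "x [^] k \<noteq> \<one>"
    using g assms generate_one by (metis generate.incl insertI1 singletonD)
  with g show ?thesis
    using assms by (simp add: generators_def)
qed

lemma card_generators_ge_2: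
  assumes "C \<in> nontriv_cyclic G"
  shows "card (generators G C) \<ge> 2"
proof -
  obtain x where x: "x \<in> carrier G" "x \<noteq> \<one>" and C: "C = generate G {x}"
    using assms by (auto simp: nontriv_cyclic_def)
  have "(\<lambda>k::int. x [^] k) ` {1, -1} \<subseteq> generators G C"
    using int_pow_in_generators[OF x] by (auto simp: C simp del: int_pow_1)
  moreover have "inj_on (\<lambda>k::int. x [^] k) {1, -1}"
    using x eq_one_if_ord_dvd_2[of x] by (auto simp: inj_on_def int_pow_eq simp del: int_pow_1)
  then have "card ((\<lambda>k::int. x [^] k) ` {1, -1}) = 2"
    by (subst card_image) auto
  ultimately show ?thesis
    using card_mono[OF finite_generators] by metis
qed

text \<open>Two of these exponents differ by 1, 2, 3 or 4 up to sign. An odd order that divides one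
  of these numbers is 1 or 3, and then the cube of \<open>x\<close> is trivial.\<close>

lemma card_powers_eq_4:
  assumes x: "x \<in> carrier G" and "x [^] (3::nat) \<noteq> \<one>"
  shows "card ((\<lambda>k::int. x [^] k) ` {1, -1, 2, -2}) = 4"
proof -
  have "x \<noteq> \<one>" using assms by auto
  have "\<not> int (ord x) dvd 3"
    using assms pow_eq_id[of x 3] by (metis int_dvd_int_iff of_nat_numeral)
  moreover have "\<not> int (ord x) dvd 2" "\<not> int (ord x) dvd 1" "\<not> int (ord x) dvd 4"
    using dvd_2_ord[of x 1] dvd_2_ord[of x 2] eq_one_if_ord_dvd_2[of x] x \<open>x \<noteq> \<one>\<close> by auto
  ultimately have "inj_on (\<lambda>k::int. x [^] k) {1, -1, 2, -2}"
    using x by (auto simp: inj_on_def int_pow_eq simp del: int_pow_1)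
  then show ?thesis
    by (subst card_image) auto
qed

lemma powers_subset_generators:
  assumes x: "x \<in> carrier G" and "x [^] (3::nat) \<noteq> \<one>"
  shows "(\<lambda>k::int. x [^] k) ` {1, -1, 2, -2} \<subseteq> generators G (generate G {x})"
proof -
  have "x \<noteq> \<one>" using assms by auto
  then show ?thesis
    using int_pow_in_generators[OF x] odd_ord[OF x] by (auto simp del: int_pow_1)
qed

text \<open>Exponents of \<open>x\<close> matter only modulo 3, and residue 0 gives the identity,
  which is not counted as a generator.\<close>

lemma card_generators_le_2:
  assumes x: "x \<in> carrier G" and "x [^] (3::nat) = \<one>"
  shows "card (generators G (generate G {x})) \<le> 2"
proof -
  have d: "int (ord x) dvd 3"
    using assms pow_eq_id[of x 3] by (metis int_dvd_int_iff of_nat_numeral)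
  have "generators G (generate G {x}) \<subseteq> {x [^] (1::int), x [^] (2::int)}"
  proof
    fix y assume y: "y \<in> generators G (generate G {x})"
    then have "y \<in> carrier G" "y \<noteq> \<one>" "y \<in> generate G {x}"
      using generate.incl[of y "{y}" G] by (auto simp: generators_def)
    then obtain k :: int where k: "y = x [^] k"
      using generate_singleton_eq_range[OF x] by auto
    have "3 dvd k mod 3 - k"
      by (simp flip: mod_eq_dvd_iff)
    then have "x [^] k = x [^] (k mod 3)"
      using x d dvd_trans by (auto simp: int_pow_eq)
    moreover have "k mod 3 = 0 \<or> k mod 3 = 1 \<or> k mod 3 = 2"
      by presburger
    ultimately show "y \<in> {x [^] (1::int), x [^] (2::int)}"
      using k \<open>y \<noteq> \<one>\<close> by (auto simp del: int_pow_1)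
  qed
  then have "card (generators G (generate G {x})) \<le> card {x [^] (1::int), x [^] (2::int)}"
    by (rule card_mono[rotated]) simp
  also have "\<dots> \<le> 2"
    by (simp add: card_insert_if)
  finally show ?thesis .
qed

text \<open>The assumption \<open>cubes\<close> is what the case \<open>r = -1\<close> provides:
  only the four known generators of \<open>generate G {x}\<close> have a nontrivial cube.\<close>

lemma ord_5_and_generates:
  assumes x: "x \<in> carrier G" and x3: "x [^] (3::nat) \<noteq> \<one>"
    and cubes: "\<And>y. y \<in> carrier G \<Longrightarrow> y [^] (3::nat) \<noteq> \<one> \<Longrightarrow> y \<in> (\<lambda>k::int. x [^] k) ` {1, -1, 2, -2}"
  shows "ord x = 5" and "carrier G = generate G {x}"
proof -
  have "x \<noteq> \<one>" using assms by auto
  have n3: "\<not> int (ord x) dvd 3"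
    using assms pow_eq_id[of x 3] by (metis int_dvd_int_iff of_nat_numeral)
  have n: "\<not> int (ord x) dvd 2" "\<not> int (ord x) dvd 6" "\<not> int (ord x) dvd 12"
    using dvd_2_ord[OF x, of 3] dvd_2_ord[OF x, of 6] eq_one_if_ord_dvd_2[OF x] n3 \<open>x \<noteq> \<one>\<close> by auto
  \<comment> \<open>The fourth power has nontrivial cube, since \<open>ord x\<close> does not divide
    12, so it is among the four listed powers. The differences of 4 and the exponents 1, -1, 2, -2
    are 3, 5, 2, 6, and only 5 can be a multiple of \<open>ord x\<close>.\<close>
  have "(x [^] (4::int)) [^] (3::int) \<noteq> x [^] (0::int)"
    using x n by (simp only: int_pow_pow int_pow_eq) simp
  then have "(x [^] (4::int)) [^] (3::nat) \<noteq> \<one>"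
    by (metis int_pow_0 int_pow_int of_nat_numeral)
  then have "x [^] (4::int) \<in> (\<lambda>k::int. x [^] k) ` {1, -1, 2, -2}"
    using cubes x by auto
  then have "int (ord x) dvd 5"
    using x n n3 by (auto simp: int_pow_eq simp del: int_pow_1)
  then have "ord x dvd 5"
    by (metis int_dvd_int_iff of_nat_numeral)
  moreover from this have "ord x \<in> {0, 1, 2, 3, 4, 5}"
    using dvd_imp_le[of "ord x" 5] by auto
  ultimately show o: "ord x = 5"
    using \<open>x \<noteq> \<one>\<close> x ord_eq_1 by auto
  have "y \<in> generate G {x}" if y: "y \<in> carrier G" for y
  proof (cases "y [^] (3::nat) = \<one>")
    case False
    then show ?thesis
      using cubes y generate_singleton_eq_range[OF x] by blast
  next
    case True
    then have y3: "y \<otimes> (y \<otimes> y) = \<one>"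
      using y by (simp add: numeral_3_eq_3 m_assoc)
    have inv_y: "inv y \<otimes> (y \<otimes> z) = z" if "z \<in> carrier G" for z
      using y that by (simp flip: m_assoc)
    have conj_pow: "y \<otimes> a [^] (m::nat) \<otimes> inv y = (y \<otimes> a \<otimes> inv y) [^] m"
      if a: "a \<in> carrier G" for a m
    proof (induction m)
      case (Suc m)
      have "y \<otimes> a [^] Suc m \<otimes> inv y = (y \<otimes> a [^] m \<otimes> inv y) \<otimes> (y \<otimes> a \<otimes> inv y)"
        using a y by (simp add: m_assoc inv_y)
      then show ?case using Suc by simp
    qed (use y in simp)
    \<comment> \<open>Conjugation preserves the nontriviality of the cube, so \<open>cubes\<close>
      applies to the conjugate of \<open>x\<close> as well.\<close>
    have "y \<otimes> x [^] (3::nat) \<otimes> inv y \<noteq> \<one>"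
    proof
      assume "y \<otimes> x [^] (3::nat) \<otimes> inv y = \<one>"
      then have "y \<otimes> x [^] (3::nat) = y"
        using x y inv_solve_right'[of \<one> "y \<otimes> x [^] (3::nat)" y] by simp
      then show False
        using x y x3 r_cancel_one[of y "x [^] (3::nat)"] by simp
    qed
    then have "y \<otimes> x \<otimes> inv y \<in> (\<lambda>k::int. x [^] k) ` {1, -1, 2, -2}"
      using conj_pow[OF x] x y by (intro cubes) simp_all
    \<comment> \<open>Modulo 5 the exponents become natural numbers, the form that
      \<open>conj_pow\<close> handles.\<close>
    moreover have "x [^] (-1::int) = x [^] (4::nat)" "x [^] (-2::int) = x [^] (3::nat)"
      "x [^] (2::int) = x [^] (2::nat)" "x [^] (1::int) = x [^] (1::nat)"
      using x o by (simp_all add: int_pow_eq flip: int_pow_int del: int_pow_1)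
    ultimately have "y \<otimes> x \<otimes> inv y \<in> (\<lambda>k::nat. x [^] k) ` {1, 2, 3, 4}"
      by (simp only: image_insert image_empty insert_iff empty_iff) blast
    then obtain k :: nat where k: "y \<otimes> x \<otimes> inv y = x [^] k" "k \<in> {1, 2, 3, 4}"
      by blast
    have step: "y \<otimes> x [^] (m::nat) \<otimes> inv y = x [^] (k * m)" for m
      using conj_pow[OF x] k(1) x by (simp add: nat_pow_pow)
    \<comment> \<open>Conjugating by \<open>y\<close> three times is conjugating by the identity,
      while each round multiplies the exponent by \<open>k\<close>.\<close>
    have "x = (y \<otimes> (y \<otimes> y)) \<otimes> x \<otimes> inv (y \<otimes> (y \<otimes> y))"
      using y3 x by simp
    also have "\<dots> = y \<otimes> (y \<otimes> (y \<otimes> x \<otimes> inv y) \<otimes> inv y) \<otimes> inv y"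
      using x y by (simp add: m_assoc inv_mult_group)
    also have "\<dots> = x [^] (k * (k * k))"
      by (simp only: k(1) step)
    finally have "x [^] int (k * (k * k)) = x [^] (1::int)"
      using x by (simp only: int_pow_int int_pow_1)
    then have "int 5 dvd 1 - int (k * (k * k))"
      using x o int_pow_eq by metis
    \<comment> \<open>Cubing permutes the nonzero residues modulo 5, as 3 is coprime to 4, so 1 is
      the only cube root of 1.\<close>
    then have "k = 1"
      using k(2) by auto
    then have "y \<otimes> x \<otimes> inv y = x"
      using k x by simp
    then have c: "y \<otimes> x = x \<otimes> y"
      using x y by (metis inv_solve_right' m_closed)
    have "(y \<otimes> x) [^] (3::nat) = x [^] (3::nat)"
      using pow_mult_distrib[OF c y x, of 3] True x by simp
    then have "y \<otimes> x \<in> generate G {x}"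
      using x3 cubes[of "y \<otimes> x"] x y unfolding generate_singleton_eq_range[OF x] by (simp only: m_closed) blast
    then obtain j :: int where "y \<otimes> x = x [^] j"
      using generate_singleton_eq_range[OF x] by auto
    then have "y = x [^] j \<otimes> inv x"
      using x y by (metis inv_solve_right int_pow_closed)
    also have "\<dots> = x [^] (j - 1)"
      using x by (simp add: int_pow_diff)
    finally show ?thesis
      using generate_singleton_eq_range[OF x] by blast
  qed
  then show "carrier G = generate G {x}"
    using x generate_incl[of "{x}"] by auto
qed

end

section \<open>Isomorphism types and the exponent\<close>

lemma (in group) iso_integer_mod_group:
  assumes x: "x \<in> carrier G" and "finite (carrier G)" and gen: "carrier G = generate G {x}"
  shows "G \<cong> integer_mod_group (ord x)"
proof -
  \<comment> \<open>Positivity matters: \<open>integer_mod_group 0\<close> is the infinite cyclic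
    group.\<close>
  have pos: "ord x > 0"
    using assms ord_ge_1[of x] by simp
  have m: "x [^] (k mod int (ord x)) = x [^] k" for k :: int
    using x by (simp add: int_pow_eq mod_eq_dvd_iff[symmetric])
  have "(\<lambda>k::int. x [^] k) \<in> iso (integer_mod_group (ord x)) G"
  proof (rule isoI)
    show "(\<lambda>k::int. x [^] k) \<in> hom (integer_mod_group (ord x)) G"
      using x by (auto simp: hom_def m int_pow_mult)
    have "inj_on (\<lambda>k::int. x [^] k) {0..<int (ord x)}"
      using x by (auto simp: inj_on_def int_pow_eq simp flip: mod_eq_dvd_iff)
    moreover have "(\<lambda>k::int. x [^] k) ` {0..<int (ord x)} = carrier G"
    proof
      show "carrier G \<subseteq> (\<lambda>k::int. x [^] k) ` {0..<int (ord x)}"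
      proof
        fix y assume "y \<in> carrier G"
        then obtain k :: int where "y = x [^] k"
          using gen generate_singleton_eq_range[OF x] by auto
        then show "y \<in> (\<lambda>k::int. x [^] k) ` {0..<int (ord x)}"
          using m[of k] pos by (intro image_eqI[where x = "k mod int (ord x)"]) auto
      qed
    qed (use x in auto)
    ultimately show "bij_betw (\<lambda>k::int. x [^] k) (carrier (integer_mod_group (ord x))) (carrier G)"
      using pos by (simp add: bij_betw_def carrier_integer_mod_group)
  qed
  then show ?thesis
    using group.iso_sym[OF group_integer_mod_group] by (auto simp: is_iso_def)
qed

lemma (in group) iso_singleton_iff:
  "G \<cong> singleton_group () \<longleftrightarrow> carrier G = {\<one>}"
proof
  assume "G \<cong> singleton_group ()"
  then have "card (carrier G) = 1"
    using iso_same_card by fastforce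
  then show "carrier G = {\<one>}"
    by (metis card_1_singletonE one_closed singletonD)
next
  assume "carrier G = {\<one>}"
  then have "(\<lambda>_. ()) \<in> iso G (singleton_group ())"
    by (auto simp: iso_def hom_def bij_betw_def)
  then show "G \<cong> singleton_group ()"
    by (auto simp: is_iso_def)
qed

text \<open>Merges the two alternatives for \<open>r = 0\<close> into one condition on elements; the
  trivial group is listed separately because its exponent is 1.\<close>

lemma (in group) exponent_3_or_trivial_iff:
  assumes "finite (carrier G)"
  shows "carrier G = {\<one>} \<or> group_exponent G = 3 \<longleftrightarrow> (\<forall>x\<in>carrier G. x [^] (3::nat) = \<one>)"
proof -
  let ?P = "\<lambda>n::nat. 0 < n \<and> (\<forall>x\<in>carrier G. x [^] n = \<one>)"
  have "?P (order G)"
    using assms pow_order_eq_1 order_gt_0_iff_finite by blast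
  then have ex: "?P (group_exponent G)"
    unfolding group_exponent_def by (rule LeastI)
  show ?thesis
  proof
    assume "carrier G = {\<one>} \<or> group_exponent G = 3"
    then show "\<forall>x\<in>carrier G. x [^] (3::nat) = \<one>"
      using ex by auto
  next
    assume c: "\<forall>x\<in>carrier G. x [^] (3::nat) = \<one>"
    then have le: "group_exponent G \<le> 3"
      unfolding group_exponent_def by (intro Least_le) simp
    \<comment> \<open>An exponent below 3 divides 2, so \<open>ord x\<close> divides both 2 and 3,
      hence their difference 1.\<close>
    have "x = \<one>" if x: "x \<in> carrier G" and ne: "group_exponent G \<noteq> 3" for x
    proof -
      have "group_exponent G = 1 \<or> group_exponent G = 2"
        using le ne ex by linarith
      then have "group_exponent G dvd 2"
        by auto
      moreover have "ord x dvd group_exponent G"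
        using ex x pow_eq_id[OF x] by blast
      ultimately have "ord x dvd 2"
        by (rule dvd_trans[rotated])
      moreover have "ord x dvd 3"
        using c x pow_eq_id[OF x] by blast
      ultimately have "ord x dvd 3 - 2"
        by (intro dvd_diff_nat)
      then show ?thesis
        using x ord_eq_1 by simp
    qed
    then show "carrier G = {\<one>} \<or> group_exponent G = 3"
      by auto
  qed
qed

section \<open>Classification by the excess of generators\<close>

context odd_group
begin

lemma sum_excess:
  assumes "2 * int (card (cyclic_subgroups G)) = int (order G) + 2 * r + 1"
  shows "(\<Sum>C \<in> nontriv_cyclic G. int (card (generators G C)) - 2) = - 2 * r"
  using assms order_eq_sum_card_generators[OF fin] card_cyclic_subgroups[OF fin]
  by (simp add: sum_subtractf)

lemma classification:
  assumes eq: "2 * int (card (cyclic_subgroups G)) = int (order G) + 2 * r + 1" and r: "r \<ge> -1"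
  shows "r = 0 \<and> (\<forall>x\<in>carrier G. x [^] (3::nat) = \<one>) \<or> r = -1 \<and> G \<cong> integer_mod_group 5"
proof (cases "\<forall>x\<in>carrier G. x [^] (3::nat) = \<one>")
  case True
  then have "int (card (generators G C)) - 2 = 0" if "C \<in> nontriv_cyclic G" for C
    using that card_generators_ge_2[OF that] card_generators_le_2
    by (force simp: nontriv_cyclic_def)
  then have "r = 0"
    using sum_excess[OF eq] by simp
  with True show ?thesis by simp
next
  case False
  then obtain x where x: "x \<in> carrier G" and x3: "x [^] (3::nat) \<noteq> \<one>"
    by blast
  define f where "f C = int (card (generators G C)) - 2" for C
  have finK: "finite (nontriv_cyclic G)"
    using fin by (simp add: nontriv_cyclic_def)
  have f0: "f C \<ge> 0" if "C \<in> nontriv_cyclic G" for C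
    using card_generators_ge_2[OF that] by (simp add: f_def)
  have f2: "f (generate G {y}) \<ge> 2" "generate G {y} \<in> nontriv_cyclic G"
    if y: "y \<in> carrier G" "y [^] (3::nat) \<noteq> \<one>" for y
  proof -
    have "4 \<le> card (generators G (generate G {y}))"
      using card_mono[OF finite_generators powers_subset_generators[OF y]]
      unfolding card_powers_eq_4[OF y] .
    then show "f (generate G {y}) \<ge> 2"
      by (simp add: f_def)
    have "y \<noteq> \<one>"
      using y by auto
    then show "generate G {y} \<in> nontriv_cyclic G"
      using y by (simp add: nontriv_cyclic_def)
  qed
  \<comment> \<open>The subgroup generated by \<open>x\<close> contributes at least 2 and all others
    at least 0, so \<open>- 2 * r \<ge> 2\<close>. With \<open>r \<ge> -1\<close> every bound is
    attained.\<close>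
  have sum: "f (generate G {x}) + (\<Sum>C \<in> nontriv_cyclic G - {generate G {x}}. f C) = - 2 * r"
    using sum_excess[OF eq] sum.remove[OF finK f2(2)[OF x x3], of f] by (simp add: f_def)
  moreover have nn: "(\<Sum>C \<in> nontriv_cyclic G - {generate G {x}}. f C) \<ge> 0"
    using f0 by (intro sum_nonneg) auto
  ultimately have r1: "r = -1" and fx: "f (generate G {x}) = 2"
    and s0: "(\<Sum>C \<in> nontriv_cyclic G - {generate G {x}}. f C) = 0"
    using f2(1)[OF x x3] r by auto
  \<comment> \<open>Excess exactly 2 means exactly four generators, so the four known powers exhaust
    them.\<close>
  have gens: "generators G (generate G {x}) = (\<lambda>k::int. x [^] k) ` {1, -1, 2, -2}"
  proof (rule sym, rule card_subset_eq[OF finite_generators powers_subset_generators[OF x x3]])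
    show "card ((\<lambda>k::int. x [^] k) ` {1, -1, 2, -2}) = card (generators G (generate G {x}))"
      unfolding card_powers_eq_4[OF x x3] using fx by (simp add: f_def)
  qed
  \<comment> \<open>Every other subgroup has excess 0, but the one generated by \<open>y\<close> has
    excess at least 2; so the two coincide.\<close>
  have "y \<in> generators G (generate G {x})" if y: "y \<in> carrier G" "y [^] (3::nat) \<noteq> \<one>" for y
  proof -
    have "f C = 0" if "C \<in> nontriv_cyclic G - {generate G {x}}" for C
      using s0 that sum_nonneg_eq_0_iff[of "nontriv_cyclic G - {generate G {x}}" f] f0 finK by auto
    then have "generate G {y} = generate G {x}"
      using f2[OF y] by force
    then show ?thesis
      using y by (auto simp: generators_def)
  qed
  note ord_5_and_generates[OF x x3 this[unfolded gens]]
  then show ?thesis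
    using iso_integer_mod_group[OF x fin] r1 by simp
qed

text \<open>Makes the two outcomes of the classification exclusive: orders of elements would divide
  both 3 and 5, although the group has five elements.\<close>

lemma not_exponent_3_if_iso_5:
  assumes "G \<cong> integer_mod_group 5"
  shows "\<not> (\<forall>x\<in>carrier G. x [^] (3::nat) = \<one>)"
proof
  assume c: "\<forall>x\<in>carrier G. x [^] (3::nat) = \<one>"
  have o: "order G = 5"
    using iso_same_card[OF assms] by (simp add: order_def carrier_integer_mod_group)
  have "x = \<one>" if x: "x \<in> carrier G" for x
  proof -
    have "ord x dvd 3" "ord x dvd 5"
      using c x pow_eq_id[OF x, of 3] ord_dvd_group_order[OF x] o by auto
    then have "ord x dvd gcd 3 5"
      by (rule gcd_greatest)
    moreover have "gcd 3 (5::nat) = 1"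
      by (simp add: gcd_non_0_nat)
    ultimately show ?thesis
      using x ord_eq_1 by simp
  qed
  then have "carrier G = {\<one>}" by auto
  then show False
    using o by (simp add: order_def)
qed

end

theorem theorem1p5:
  fixes r :: int
  assumes "r \<ge> -1"
  shows "(\<forall>G :: ('a, 'b) monoid_scheme.
            group G \<and> finite (carrier G) \<and>
            real (card (cyclic_subgroups G)) = (real (order G) + real_of_int (2 * r + 1)) / 2 \<longrightarrow>
              (r = -1 \<longleftrightarrow> G \<cong> integer_mod_group 5) \<and>
              (r = 0 \<longleftrightarrow> G \<cong> singleton_group () \<or> group_exponent G = 3)) \<and>
         (r \<ge> 1 \<longrightarrow>
            \<not> (\<exists>G :: ('a, 'b) monoid_scheme.
                 group G \<and> finite (carrier G) \<and>
                 real (card (cyclic_subgroups G)) = (real (order G) + real_of_int (2 * r + 1)) / 2))"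
proof -
  \<comment> \<open>With the outcomes exclusive and the right-hand side of (2) rewritten as a
    condition on cubes, all three claims follow by propositional reasoning.\<close>
  have main: "(r = 0 \<and> (\<forall>x\<in>carrier G. x [^]\<^bsub>G\<^esub> (3::nat) = \<one>\<^bsub>G\<^esub>) \<and> \<not> G \<cong> integer_mod_group 5
        \<or> r = -1 \<and> G \<cong> integer_mod_group 5 \<and> \<not> (\<forall>x\<in>carrier G. x [^]\<^bsub>G\<^esub> (3::nat) = \<one>\<^bsub>G\<^esub>)) \<and>
      (G \<cong> singleton_group () \<or> group_exponent G = 3 \<longleftrightarrow> (\<forall>x\<in>carrier G. x [^]\<^bsub>G\<^esub> (3::nat) = \<one>\<^bsub>G\<^esub>))"
    if G: "group G" "finite (carrier G)"
      and eq: "real (card (cyclic_subgroups G)) = (real (order G) + real_of_int (2 * r + 1)) / 2"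
    for G :: "('a, 'b) monoid_scheme"
  proof -
    have "real_of_int (2 * int (card (cyclic_subgroups G))) = real_of_int (int (order G) + 2 * r + 1)"
      using eq by simp
    then have int_eq: "2 * int (card (cyclic_subgroups G)) = int (order G) + 2 * r + 1"
      by (simp only: of_int_eq_iff)
    have "odd (order G)"
      using int_eq by presburger
    interpret G: odd_group G
      using G \<open>odd (order G)\<close> by (simp add: odd_group_def odd_group_axioms_def)
    show ?thesis
      using G.classification[OF int_eq assms] G.not_exponent_3_if_iso_5
        G.exponent_3_or_trivial_iff[OF G(2)] G.iso_singleton_iff by blast
  qed
  show ?thesis
    using main by fastforce
qed

end
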